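(* Let $A$ be a $C^*$-algebra and let $J\subset A$ be a closed right ideal. If $J$ is topologically essential in $A$, then $J$ is thick in $A$.
   Context: A right ideal of a $C^*$-algebra $A$ is a linear subspace $I\subset A$ with $IA\subset I$. A closed right ideal $J\subset A$ is called topologically essential if $J\cap I\neq 0$ for every non-zero closed right ideal $I\subset A$. A closed right ideal $J\subset A$ is called thick if, for $a\in A$, $aJ=0$ (i.e. $ax=0$ for all $x\in J$) implies $a=0$. *)

theory Defs
  imports Complex_Main
begin

text \<open>
  C*-algebras as a type class: complex Banach algebras with a conjugate-linear,
  anti-multiplicative involution satisfying the C*-identity.
  No unit is assumed, and the zero algebra is allowed. The real normed algebra structure of the
  library is required to be the restriction of the complex one.
\<close>

class cstar_algebra = real_normed_algebra + banach +
  fixes scaleC :: "complex \<Rightarrow> 'a \<Rightarrow> 'a" (infixr \<open>*\<^sub>C\<close> 75)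
    and star :: "'a \<Rightarrow> 'a"
  assumes scaleC_add_right: "c *\<^sub>C (x + y) = c *\<^sub>C x + c *\<^sub>C y"
    and scaleC_add_left: "(c + d) *\<^sub>C x = c *\<^sub>C x + d *\<^sub>C x"
    and scaleC_scaleC: "c *\<^sub>C (d *\<^sub>C x) = (c * d) *\<^sub>C x"
    and scaleC_one: "1 *\<^sub>C x = x"
    and scaleR_scaleC: "r *\<^sub>R x = complex_of_real r *\<^sub>C x"
    and mult_scaleC_left: "(c *\<^sub>C x) * y = c *\<^sub>C (x * y)"
    and mult_scaleC_right: "x * (c *\<^sub>C y) = c *\<^sub>C (x * y)"
    and norm_scaleC: "norm (c *\<^sub>C x) = cmod c * norm x"
    and star_star: "star (star x) = x"
    and star_add: "star (x + y) = star x + star y"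
    and star_scaleC: "star (c *\<^sub>C x) = cnj c *\<^sub>C star x"
    and star_mult: "star (x * y) = star y * star x"
    and cstar_identity: "norm (star x * x) = (norm x)\<^sup>2"

instantiation complex :: cstar_algebra
begin

definition scaleC_complex :: "complex \<Rightarrow> complex \<Rightarrow> complex"
  where "scaleC_complex = (*)"

definition star_complex :: "complex \<Rightarrow> complex"
  where "star_complex = cnj"

instance
  by standard
    (simp_all add: scaleC_complex_def star_complex_def algebra_simps norm_mult
      power2_eq_square scaleR_conv_of_real)

end

lemma module_scaleC: "module (scaleC :: complex \<Rightarrow> 'a \<Rightarrow> 'a::cstar_algebra)"
  by standard
    (simp_all add: scaleC_add_right scaleC_add_left scaleC_scaleC scaleC_one)

definition right_ideal :: "'a::cstar_algebra set \<Rightarrow> bool"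
  where "right_ideal I \<longleftrightarrow> module.subspace scaleC I \<and> (\<forall>x\<in>I. \<forall>a. x * a \<in> I)"

definition topologically_essential :: "'a::cstar_algebra set \<Rightarrow> bool"
  where "topologically_essential J \<longleftrightarrow>
    (\<forall>I. right_ideal I \<and> closed I \<and> I \<noteq> {0} \<longrightarrow> J \<inter> I \<noteq> {0})"

definition thick :: "'a::cstar_algebra set \<Rightarrow> bool"
  where "thick J \<longleftrightarrow> (\<forall>a. (\<forall>x\<in>J. a * x = 0) \<longrightarrow> a = 0)"

end

theory Submission
  imports Defs
begin

text \<open>
  In a \<open>C\<^sup>*\<close>-algebra, a right ideal \<open>J\<close> behaves like a subspace of the right module \<open>A\<close> with
  its \<open>A\<close>-valued inner product \<open>\<langle>x, z\<rangle> = x\<^sup>* z\<close>: its orthogonal complement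
  \<open>J\<^sup>\<bottom> = {z. x\<^sup>* z = 0 for all x in J}\<close> is a closed right ideal, and it meets \<open>J\<close> only in \<open>0\<close>
  because \<open>x\<^sup>* x = 0\<close> forces \<open>x = 0\<close> by the \<open>C\<^sup>*\<close>-identity. A topologically essential \<open>J\<close>
  therefore has \<open>J\<^sup>\<bottom> = {0}\<close>. Applying the involution to \<open>a x = 0\<close> gives \<open>x\<^sup>* a\<^sup>* = 0\<close>, so
  \<open>a J = 0\<close> says exactly that \<open>a\<^sup>*\<close> lies in \<open>J\<^sup>\<bottom>\<close>, and thus \<open>a = 0\<close>.
\<close>

lemma star_zero: "star (0 :: 'a::cstar_algebra) = 0"
  using star_add [of "0 :: 'a" 0] by simp

lemma star_mult_self_eq_zero_iff: "star x * x = 0 \<longleftrightarrow> x = (0 :: 'a::cstar_algebra)"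
  using cstar_identity [of x] by auto

lemma right_ideal_zero:
  assumes "right_ideal J"
  shows "0 \<in> J"
  using assms module.subspace_0 [OF module_scaleC] by (auto simp: right_ideal_def)

definition orthogonal_complement :: "'a::cstar_algebra set \<Rightarrow> 'a set"
  where "orthogonal_complement S = {z. \<forall>x\<in>S. star x * z = 0}"

lemma right_ideal_orthogonal_complement: "right_ideal (orthogonal_complement S)"
proof -
  have "c *\<^sub>C (0 :: 'a) = 0" for c
    using mult_scaleC_right [of "0 :: 'a" c 0] by simp
  then show ?thesis
    by (simp add: right_ideal_def module.subspace_def [OF module_scaleC]
        orthogonal_complement_def distrib_left mult_scaleC_right mult.assoc [symmetric])
qed

lemma closed_orthogonal_complement: "closed (orthogonal_complement S)"
proof -
  have "orthogonal_complement S = (\<Inter>x\<in>S. {z. star x * z = 0})"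
    by (auto simp: orthogonal_complement_def)
  then show ?thesis
    by (auto intro!: closed_INT closed_Collect_eq continuous_intros)
qed

lemma Int_orthogonal_complement:
  assumes "0 \<in> S"
  shows "S \<inter> orthogonal_complement S = {0}"
  using assms by (auto simp: orthogonal_complement_def star_mult_self_eq_zero_iff)

lemma star_mem_orthogonal_complement_iff:
  "star a \<in> orthogonal_complement S \<longleftrightarrow> (\<forall>x\<in>S. a * x = 0)"
proof -
  have "star x * star a = 0 \<longleftrightarrow> a * x = 0" for x
    by (metis star_mult star_star star_zero)
  then show ?thesis
    by (simp add: orthogonal_complement_def)
qed

theorem proposition2p1:
  fixes J :: "'a::cstar_algebra set"
  assumes "right_ideal J" and "closed J"
    and "topologically_essential J"
  shows "thick J"
proof -
  have "orthogonal_complement J = {0}"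
    using assms(3) right_ideal_orthogonal_complement closed_orthogonal_complement
      Int_orthogonal_complement [OF right_ideal_zero [OF assms(1)]]
    by (auto simp: topologically_essential_def)
  then have "star a = 0" if "\<forall>x\<in>J. a * x = 0" for a
    using that star_mem_orthogonal_complement_iff [of a J] by simp
  then show ?thesis
    unfolding thick_def by (metis star_star star_zero)
qed

end
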